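(* Let $\mathcal{R}$ and $\mathcal{R}'$ be two recommendations for $K$ taxicabs (in the sense of the context) which differ only in their $q$-th route: the $q$-th route of $\mathcal{R}$ is $(c_1,\dots,c_{l-1})$ and the $q$-th route of $\mathcal{R}'$ is $(c_1,\dots,c_{l})$ for some $l\ge 1$, all other routes being identical. Let $t_{\mathrm{end}}$ be the arrival time of taxicab $q$ at $c_l$ under $\mathcal{R}'$. Assume that for every $k\neq q$ and every index $u$ with $c_{k,u}=c_l$ one has $t_{k,u}<t_{\mathrm{end}}$, or $t_{k,u}=t_{\mathrm{end}}$ and $k<q$. Then for every outcome $\mathbf{u}=(u_1,\dots,u_K)$ of $\mathcal{R}'$, $$p_{\mathcal{R}'}(\mathbf{u})=\begin{cases} p_{\mathcal{R}}(\mathbf{u}), & 0<u_q<l,\\ p_{\mathcal{R}}(\mathbf{u})\,P(c_l,\Delta_{q,l}), & u_q=l,\\ p_{\mathcal{R}}(\mathbf{u}-\mathbf{i}_q)\,\bigl(1-P(c_l,\Delta_{q,l})\bigr), & u_q=l+1,\end{cases}$$ where $\mathbf{i}_q$ is the vector whose entries are all $0$ except the $q$-th, which is $1$, and $\Delta_{q,l}$ is the interval associated to the tuple $(q,l)$ in $\mathcal{R}'$ for the outcome $\mathbf{u}$.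
   Context: Setting. There is a set of pick-up points $\mathcal{C}=\{1,\dots,N\}$ and an initial position $0$. $T(c,c')\ge 0$ is the travel time between points $c,c'\in\mathcal{C}\cup\{0\}$. Each pick-up point $c$ has a passenger arrival rate $\lambda_c>0$ and, for $\Delta\ge 0$, the pick-up probability $P(c,\Delta)=1-e^{-\lambda_c\Delta}$ (probability that a taxicab arriving at $c$ picks up a passenger when the previous taxicab visited $c$ a time $\Delta$ earlier, or, if it is the first visitor, when it arrives at time $\Delta$). A recommendation $\mathcal{R}=(\overrightarrow{R_1},\dots,\overrightarrow{R_K})$ is an ordered $K$-tuple of routes; route $\overrightarrow{R_k}=(c_{k,1},\dots,c_{k,l_k})$ is a sequence of $l_k\ge 0$ pairwise distinct points of $\mathcal{C}$; set $c_{k,0}=0$. All taxicabs start at $0$ at time $0$; the arrival time of taxicab $k$ at its $u$-th point is $t_{k,u}=\sum_{j=1}^{u}T(c_{k,j-1},c_{k,j})$ (so $t_{k,0}=0$). An outcome is $\mathbf{u}=(u_1,\dots,u_K)$ with $1\le u_k\le l_k+1$: taxicab $k$ picks up a passenger at its $u_k$-th point, or, if $u_k=l_k+1$, picks up nobody along its route. Intervals. Given $\mathcal{R}$ and $\mathbf{u}$, for a point $c$ consider all pairs $(k,u)$ with $1\le u\le \min(u_k,l_k)$ and $c_{k,u}=c$, sorted increasingly by $t_{k,u}$ and, for ties, by $k$. For the pair $(k,u)$ in this list, $\Delta_{k,u}=t_{k,u}-t_{k',u'}$ where $(k',u')$ is the preceding pair in the list, and $\Delta_{k,u}=t_{k,u}$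 if it is the first. Probability of an outcome: $$p_{\mathcal{R}}(\mathbf{u})=\prod_{k=1}^K\Bigl(\prod_{u=1}^{u_k-1}\bigl(1-P(c_{k,u},\Delta_{k,u})\bigr)\Bigr)\Bigl(P(c_{k,u_k},\Delta_{k,u_k})\,\mathbb{I}_{u_k\le l_k}+\mathbb{I}_{u_k=l_k+1}\Bigr),$$ where $\mathbb{I}$ is the indicator function. *)

theory Defs
  imports Complex_Main "HOL-Library.Product_Lexorder"
begin

(* Pick-up points are the naturals 1..N and 0 is the initial position.  Taxicabs (1..K) and
   positions on a route are indexed from 1.  K-tuples (of routes, of outcome entries) are
   functions on nat of which only the values on {1..K} matter. *)

type_synonym route = "nat list"

definition pickup_prob :: "(nat \<Rightarrow> real) \<Rightarrow> nat \<Rightarrow> real \<Rightarrow> real" where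
  "pickup_prob lam c d = 1 - exp (- (lam c * d))"

definition recommendation :: "nat \<Rightarrow> nat \<Rightarrow> (nat \<Rightarrow> route) \<Rightarrow> bool" where
  "recommendation N K R \<longleftrightarrow> (\<forall>k\<in>{1..K}. distinct (R k) \<and> set (R k) \<subseteq> {1..N})"

definition outcome :: "nat \<Rightarrow> (nat \<Rightarrow> route) \<Rightarrow> (nat \<Rightarrow> nat) \<Rightarrow> bool" where
  "outcome K R u \<longleftrightarrow> (\<forall>k\<in>{1..K}. 1 \<le> u k \<and> u k \<le> length (R k) + 1)"

(* The route with the initial position prepended, so that index 0 gives the point 0. *)
definition stop :: "route \<Rightarrow> nat \<Rightarrow> nat" where
  "stop r i = (0 # r) ! i"

definition arrival :: "(nat \<Rightarrow> nat \<Rightarrow> real) \<Rightarrow> route \<Rightarrow> nat \<Rightarrow> real" where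
  "arrival T r i = (\<Sum>j=1..i. T (stop r (j - 1)) (stop r j))"

(* Each visit (k, i) to c is tagged with its arrival time in front, so that the lexicographic
   order on triples sorts by time and then by k; a route never visits c twice, so the last
   component never decides. *)
definition visits ::
  "(nat \<Rightarrow> nat \<Rightarrow> real) \<Rightarrow> nat \<Rightarrow> (nat \<Rightarrow> route) \<Rightarrow> (nat \<Rightarrow> nat) \<Rightarrow> nat \<Rightarrow> (real \<times> nat \<times> nat) set" where
  "visits T K R u c =
     {(arrival T (R k) i, k, i) | k i.
        k \<in> {1..K} \<and> 1 \<le> i \<and> i \<le> min (u k) (length (R k)) \<and> stop (R k) i = c}"

definition interval ::
  "(nat \<Rightarrow> nat \<Rightarrow> real) \<Rightarrow> nat \<Rightarrow> (nat \<Rightarrow> route) \<Rightarrow> (nat \<Rightarrow> nat) \<Rightarrow> nat \<Rightarrow> nat \<Rightarrow> real" where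
  "interval T K R u k i =
     (let t = arrival T (R k) i;
          vs = sorted_list_of_set (visits T K R u (stop (R k) i));
          before = takeWhile (\<lambda>v. v \<noteq> (t, k, i)) vs
      in if before = [] then t else t - fst (last before))"

definition outcome_prob ::
  "(nat \<Rightarrow> nat \<Rightarrow> real) \<Rightarrow> (nat \<Rightarrow> real) \<Rightarrow> nat \<Rightarrow> (nat \<Rightarrow> route) \<Rightarrow> (nat \<Rightarrow> nat) \<Rightarrow> real" where
  "outcome_prob T lam K R u =
     (\<Prod>k=1..K.
        (\<Prod>i=1..u k - 1. 1 - pickup_prob lam (stop (R k) i) (interval T K R u k i)) *
        (pickup_prob lam (stop (R k) (u k)) (interval T K R u k (u k)) * of_bool (u k \<le> length (R k))
         + of_bool (u k = length (R k) + 1)))"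

end

theory Submission
  imports Defs
begin

text \<open>The added visit of taxicab q to its new last point comes after every other visit to that
  point, so it is appended at the end of the sorted list of visits and is nobody's predecessor:
  all other intervals are unchanged. Hence the products for the two recommendations have
  the same factors, except for the one contributed by the new visit itself.\<close>

lemma sorted_list_of_set_insert_greater:
  fixes A :: "'a::linorder set"
  assumes "finite A" and "\<And>a. a \<in> A \<Longrightarrow> a < m"
  shows "sorted_list_of_set (insert m A) = sorted_list_of_set A @ [m]"
proof -
  have "sorted_wrt (<) (sorted_list_of_set A @ [m])"
    using assms by (auto simp: sorted_wrt_append)
  moreover have "card (insert m A) = Suc (card A)"
    using assms by (intro card_insert_disjoint) auto
  ultimately show ?thesis
    using assms(1)
      sorted_list_of_set_unique[of "insert m A" "sorted_list_of_set A @ [m]"] by auto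
qed

lemma finite_visits: "finite (visits T K R u c)"
proof (rule finite_subset)
  show "visits T K R u c \<subseteq>
      (\<lambda>(k, i). (arrival T (R k) i, k, i)) ` (SIGMA k:{1..K}. {1..length (R k)})"
    unfolding visits_def by force
qed simp

lemma stop_append: "i \<le> length r \<Longrightarrow> stop (r @ s) i = stop r i"
  unfolding stop_def by (cases i) (auto simp: nth_append)

lemma stop_snoc: "stop (r @ [c]) (Suc (length r)) = c"
  unfolding stop_def by simp

lemma arrival_append:
  assumes "i \<le> length r"
  shows "arrival T (r @ s) i = arrival T r i"
  unfolding arrival_def using assms by (intro sum.cong refl arg_cong2[of _ _ _ _ T] stop_append) auto

lemma stop_in_set: "1 \<le> i \<Longrightarrow> i \<le> length r \<Longrightarrow> stop r i \<in> set r"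
  unfolding stop_def by (cases i) auto

text \<open>\<open>interval\<close> looks only at the part of the sorted list in front of the visit
  itself. Since that visit lies in the old list, \<open>takeWhile\<close> stops at it before it can
  reach an \<open>m\<close> appended at the end.\<close>

lemma interval_eq_if_later_visit_added:
  assumes stop_eq: "stop (R' k) i = stop (R k) i"
    and arrival_eq: "arrival T (R' k) i = arrival T (R k) i"
    and visit: "(arrival T (R k) i, k, i) \<in> visits T K R v (stop (R k) i)"
    and visits_eq: "visits T K R' u (stop (R k) i) = visits T K R v (stop (R k) i) \<or>
      (visits T K R' u (stop (R k) i) = insert m (visits T K R v (stop (R k) i)) \<and>
       (\<forall>a \<in> visits T K R v (stop (R k) i). a < m))"
  shows "interval T K R' u k i = interval T K R v k i"
proof -
  let ?x = "(arrival T (R k) i, k, i)"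
  let ?V = "visits T K R v (stop (R k) i)"
  have "takeWhile (\<lambda>y. y \<noteq> ?x) (sorted_list_of_set (visits T K R' u (stop (R k) i)))
      = takeWhile (\<lambda>y. y \<noteq> ?x) (sorted_list_of_set ?V)"
    using visits_eq
  proof
    assume ins: "visits T K R' u (stop (R k) i) = insert m ?V \<and> (\<forall>a\<in>?V. a < m)"
    then have "sorted_list_of_set (visits T K R' u (stop (R k) i)) = sorted_list_of_set ?V @ [m]"
      using sorted_list_of_set_insert_greater[OF finite_visits] by metis
    moreover have "?x \<in> set (sorted_list_of_set ?V)"
      using visit finite_visits by simp
    ultimately show ?thesis
      by (simp add: takeWhile_append1)
  qed simp
  then show ?thesis
    unfolding interval_def Let_def stop_eq arrival_eq by simp
qed

text \<open>The outcome \<open>v\<close> for the shorter recommendation may differ from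
  \<open>u\<close> at \<open>q\<close>, as long as both make taxicab q visit the same points of
  \<open>cs\<close>. This freedom covers both \<open>v = u\<close> and the outcome with entry
  \<open>q\<close> lowered by one, so a single lemma serves all three cases of the theorem.\<close>

lemma interval_route_extension:
  assumes dist: "distinct (cs @ [cl])"
    and q: "q \<in> {1..K}"
    and other: "\<And>k. k \<in> {1..K} \<Longrightarrow> k \<noteq> q \<Longrightarrow> R' k = R k"
    and Rq: "R q = cs" and R'q: "R' q = cs @ [cl]"
    and last: "\<And>k i. k \<in> {1..K} \<Longrightarrow> k \<noteq> q \<Longrightarrow> i \<in> {1..length (R' k)} \<Longrightarrow> stop (R' k) i = cl \<Longrightarrow>
           arrival T (R' k) i < arrival T (R' q) (Suc (length cs)) \<or>
           arrival T (R' k) i = arrival T (R' q) (Suc (length cs)) \<and> k < q"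
    and v: "\<And>k. k \<noteq> q \<Longrightarrow> v k = u k"
    and vq: "min (v q) (length cs) = min (u q) (length cs)"
    and k: "k \<in> {1..K}" and i: "1 \<le> i" "i \<le> min (u k) (length (R k))"
  shows "interval T K R' u k i = interval T K R v k i"
proof -
  let ?m = "(arrival T (R' q) (Suc (length cs)), q, Suc (length cs))"
  have pos: "stop (R' j) n = stop (R j) n \<and> arrival T (R' j) n = arrival T (R j) n"
    if "j \<in> {1..K}" "n \<le> length (R j)" for j n
    using that other Rq R'q by (cases "j = q") (auto simp: stop_append arrival_append)
  \<comment> \<open>\<open>visits\<close> depends on an outcome only through this truncation, so
    under \<open>R\<close> the outcomes \<open>u\<close> and \<open>v\<close> give the same
    visits.\<close>
  have len: "n \<le> min (v j) (length (R j)) \<longleftrightarrow> n \<le> min (u j) (length (R j))" for j n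
    using v vq Rq by (cases "j = q") auto
  have visit_iff: "(t, j, n) \<in> visits T K R' u c \<longleftrightarrow> (t, j, n) \<in> visits T K R v c \<or>
      (t, j, n) = ?m \<and> c = cl \<and> Suc (length cs) \<le> u q" for t j n c
  proof (cases "j \<in> {1..K}")
    case True
    show ?thesis
    proof (cases "n \<le> length (R j)")
      case le: True
      have "n \<le> length (R' j)"
        using le True other[of j] Rq R'q by (cases "j = q") auto
      moreover have "(t, j, n) \<noteq> ?m" using le Rq by auto
      ultimately show ?thesis
        using len[of n j] pos[OF True le] le True unfolding visits_def by auto
    next
      \<comment> \<open>Past the end of \<open>R j\<close> there is no visit under \<open>R\<close>.
        Under \<open>R'\<close> only route \<open>q\<close> is longer, and by one position, which is
        reached only if q has not picked up anybody on \<open>cs\<close>.\<close>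
      case gt: False
      have "(t, j, n) \<in> visits T K R' u c \<longleftrightarrow> (t, j, n) = ?m \<and> c = cl \<and> Suc (length cs) \<le> u q"
      proof (cases "j = q")
        case True
        then show ?thesis
          using gt q Rq R'q stop_snoc[of cs cl] unfolding visits_def
          by (auto simp: le_Suc_eq)
      next
        case False
        then show ?thesis using gt other[of j] True unfolding visits_def by auto
      qed
      then show ?thesis using gt unfolding visits_def by auto
    qed
  next
    case False
    then show ?thesis using q unfolding visits_def by auto
  qed
  \<comment> \<open>Distinctness of the extended route excludes an earlier visit of q itself to
    \<open>cl\<close>. For the other taxicabs, \<open>last\<close> is exactly the lexicographic
    comparison by time and then by taxicab.\<close>
  have less: "a < ?m" if a: "a \<in> visits T K R v cl" for a
  proof -
    obtain j n where a_eq: "a = (arrival T (R j) n, j, n)" and j: "j \<in> {1..K}"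
      and n: "1 \<le> n" "n \<le> length (R j)" and at: "stop (R j) n = cl"
      using a unfolding visits_def by auto
    have "j \<noteq> q"
      using stop_in_set[OF n] at Rq dist by auto
    then show ?thesis
      using last[of j n] other[of j] j n at a_eq by auto
  qed
  show ?thesis
  proof (rule interval_eq_if_later_visit_added[where m = ?m])
    show "(arrival T (R k) i, k, i) \<in> visits T K R v (stop (R k) i)"
      using k i len[of i k] unfolding visits_def by auto
    show "visits T K R' u (stop (R k) i) = visits T K R v (stop (R k) i) \<or>
      (visits T K R' u (stop (R k) i) = insert ?m (visits T K R v (stop (R k) i)) \<and>
       (\<forall>a \<in> visits T K R v (stop (R k) i). a < ?m))"
    proof (cases "stop (R k) i = cl \<and> Suc (length cs) \<le> u q")
      case True
      then have "visits T K R' u (stop (R k) i) = insert ?m (visits T K R v (stop (R k) i))"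
        using visit_iff by (intro set_eqI) (auto simp: split_paired_all)
      then show ?thesis using less True by auto
    next
      case False
      then have "visits T K R' u (stop (R k) i) = visits T K R v (stop (R k) i)"
        using visit_iff by (intro set_eqI) (auto simp: split_paired_all)
      then show ?thesis by blast
    qed
  qed (use pos[OF k] i in auto)
qed

theorem theorem1:
  fixes N K q l cl :: nat
    and T :: "nat \<Rightarrow> nat \<Rightarrow> real"
    and lam :: "nat \<Rightarrow> real"
    and R R' :: "nat \<Rightarrow> route"
    and cs :: route
    and t_end :: real
    and u :: "nat \<Rightarrow> nat"
  assumes T_nonneg: "\<And>c c'. c \<in> {0..N} \<Longrightarrow> c' \<in> {0..N} \<Longrightarrow> T c c' \<ge> 0"
    and lam_pos: "\<And>c. c \<in> {1..N} \<Longrightarrow> lam c > 0"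
    and "recommendation N K R"
    and "recommendation N K R'"
    and "q \<in> {1..K}"
    and "\<And>k. k \<in> {1..K} \<Longrightarrow> k \<noteq> q \<Longrightarrow> R' k = R k"
    and "l \<ge> 1"
    and "length cs = l - 1"
    and "R q = cs"
    and "R' q = cs @ [cl]"
    and "t_end = arrival T (R' q) l"
    and "\<And>k i. k \<in> {1..K} \<Longrightarrow> k \<noteq> q \<Longrightarrow> i \<in> {1..length (R' k)} \<Longrightarrow> stop (R' k) i = cl \<Longrightarrow>
           arrival T (R' k) i < t_end \<or> arrival T (R' k) i = t_end \<and> k < q"
    and "outcome K R' u"
  shows "(0 < u q \<and> u q < l \<longrightarrow>
            outcome_prob T lam K R' u = outcome_prob T lam K R u) \<and>
         (u q = l \<longrightarrow>
            outcome_prob T lam K R' u =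
              outcome_prob T lam K R u * pickup_prob lam cl (interval T K R' u q l)) \<and>
         (u q = l + 1 \<longrightarrow>
            outcome_prob T lam K R' u =
              outcome_prob T lam K R (\<lambda>k. u k - (if k = q then 1 else 0)) *
              (1 - pickup_prob lam cl (interval T K R' u q l)))"
proof -
  note rec' = assms(4) and q = assms(5) and other = assms(6) and Rq = assms(9)
    and R'q = assms(10) and out = assms(13)
  have l: "l = Suc (length cs)" using assms(7,8) by simp
  have dist: "distinct (cs @ [cl])"
    using rec' q R'q unfolding recommendation_def by force
  define fac where "fac R u k =
      (\<Prod>i=1..u k - 1. 1 - pickup_prob lam (stop (R k) i) (interval T K R u k i)) *
      (pickup_prob lam (stop (R k) (u k)) (interval T K R u k (u k)) * of_bool (u k \<le> length (R k))
        + of_bool (u k = length (R k) + 1))" for R u k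
  \<comment> \<open>Isolating the factor of taxicab q leaves a product over the other taxicabs that
    is common to all three cases.\<close>
  have split: "outcome_prob T lam K R u = fac R u q * (\<Prod>k\<in>{1..K} - {q}. fac R u k)" for R u
    unfolding outcome_prob_def fac_def using q by (intro prod.remove) auto
  have visit_eq: "1 - pickup_prob lam (stop (R' k) i) (interval T K R' u k i)
        = 1 - pickup_prob lam (stop (R k) i) (interval T K R v k i)"
      "pickup_prob lam (stop (R' k) i) (interval T K R' u k i)
        = pickup_prob lam (stop (R k) i) (interval T K R v k i)"
    if "\<And>k. k \<noteq> q \<Longrightarrow> v k = u k" "min (v q) (length cs) = min (u q) (length cs)"
      "k \<in> {1..K}" "1 \<le> i" "i \<le> min (u k) (length (R k))" for v k i
  proof -
    have "interval T K R' u k i = interval T K R v k i"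
      using dist q other Rq R'q assms(12)[unfolded assms(11) l] that
      by (rule interval_route_extension)
    moreover have "stop (R' k) i = stop (R k) i"
      using that other[of k] Rq R'q by (cases "k = q") (auto simp: stop_append)
    ultimately show "1 - pickup_prob lam (stop (R' k) i) (interval T K R' u k i)
        = 1 - pickup_prob lam (stop (R k) i) (interval T K R v k i)"
      "pickup_prob lam (stop (R' k) i) (interval T K R' u k i)
        = pickup_prob lam (stop (R k) i) (interval T K R v k i)" by simp_all
  qed
  have rest: "(\<Prod>k\<in>{1..K} - {q}. fac R' u k) = (\<Prod>k\<in>{1..K} - {q}. fac R v k)"
    if v: "\<And>k. k \<noteq> q \<Longrightarrow> v k = u k" "min (v q) (length cs) = min (u q) (length cs)" for v
  proof (rule prod.cong)
    fix k assume "k \<in> {1..K} - {q}"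
    then have k: "k \<in> {1..K}" "k \<noteq> q" by auto
    have u: "1 \<le> u k" "u k \<le> length (R k) + 1"
      using out k other[OF k] unfolding outcome_def by force+
    have "(\<Prod>i=1..u k - 1. 1 - pickup_prob lam (stop (R' k) i) (interval T K R' u k i))
        = (\<Prod>i=1..u k - 1. 1 - pickup_prob lam (stop (R k) i) (interval T K R v k i))"
      using u by (intro prod.cong refl visit_eq(1) v k(1)) auto
    \<comment> \<open>If \<open>u k\<close> is \<open>length (R k) + 1\<close>, no visit belongs to
      it and the intervals need not agree there; the indicator then multiplies the pick-up term by
      0.\<close>
    moreover have "pickup_prob lam (stop (R' k) (u k)) (interval T K R' u k (u k))
        = pickup_prob lam (stop (R k) (u k)) (interval T K R v k (u k))" if "u k \<le> length (R k)"
      using u that by (intro visit_eq(2) v k(1)) auto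
    ultimately show "fac R' u k = fac R v k"
      unfolding fac_def v(1)[OF k(2)] other[OF k] by (cases "u k \<le> length (R k)") auto
  qed simp
  have before: "(\<Prod>i=1..n. 1 - pickup_prob lam (stop (R' q) i) (interval T K R' u q i))
      = (\<Prod>i=1..n. 1 - pickup_prob lam (stop (R q) i) (interval T K R v q i))"
    if v: "\<And>k. k \<noteq> q \<Longrightarrow> v k = u k" "min (v q) (length cs) = min (u q) (length cs)"
      and n: "n \<le> u q" "n \<le> length cs" for v n
    using n Rq by (intro prod.cong refl visit_eq(1) v q) auto
  have stop_l: "stop (R' q) l = cl"
    unfolding R'q l by (rule stop_snoc)
  show ?thesis
  proof (intro conjI impI)
    \<comment> \<open>Here \<open>u q\<close> is at most \<open>length cs\<close>, so taxicab q
      picks up within the common part and the indicators take the same values for both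
      routes.\<close>
    assume uq: "0 < u q \<and> u q < l"
    have "pickup_prob lam (stop (R' q) (u q)) (interval T K R' u q (u q))
        = pickup_prob lam (stop (R q) (u q)) (interval T K R u q (u q))"
      using uq l Rq by (intro visit_eq(2) q) auto
    moreover have "(\<Prod>i=1..u q - 1. 1 - pickup_prob lam (stop (R' q) i) (interval T K R' u q i))
        = (\<Prod>i=1..u q - 1. 1 - pickup_prob lam (stop (R q) i) (interval T K R u q i))"
      using uq l by (intro before) auto
    ultimately have "fac R' u q = fac R u q"
      unfolding fac_def using uq l Rq R'q by simp
    then show "outcome_prob T lam K R' u = outcome_prob T lam K R u"
      using rest[of u] by (simp add: split)
  next
    assume uq: "u q = l"
    \<comment> \<open>The value \<open>l\<close> is \<open>length cs + 1\<close>: for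
      \<open>R\<close> it means that q finds nobody, which contributes the factor 1, while for
      \<open>R'\<close> it means a pick-up at \<open>cl\<close>.\<close>
    have "fac R' u q = fac R u q * pickup_prob lam cl (interval T K R' u q l)"
      unfolding fac_def using before[of u "u q - 1"] uq l Rq R'q stop_l by auto
    then show "outcome_prob T lam K R' u
        = outcome_prob T lam K R u * pickup_prob lam cl (interval T K R' u q l)"
      using rest[of u] by (simp add: split)
  next
    assume uq: "u q = l + 1"
    \<comment> \<open>Both \<open>u q = l + 1\<close> and \<open>v q = l\<close> encode that q finds
      nobody, on \<open>R' q\<close> and on \<open>R q\<close> respectively. Both truncate to
      \<open>length cs\<close>, so the intervals on \<open>cs\<close> agree.\<close>
    define v where "v = (\<lambda>k. u k - (if k = q then 1 else 0))"
    have v: "\<And>k. k \<noteq> q \<Longrightarrow> v k = u k" "min (v q) (length cs) = min (u q) (length cs)"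
      and vq: "v q = l"
      using uq l unfolding v_def by auto
    have "fac R' u q = (\<Prod>i=1..l. 1 - pickup_prob lam (stop (R' q) i) (interval T K R' u q i))"
      unfolding fac_def using uq l R'q by simp
    \<comment> \<open>The last factor of the product is the unsuccessful visit to \<open>cl\<close>;
      the remaining ones concern points of \<open>cs\<close>.\<close>
    also have "\<dots> = (\<Prod>i=1..length cs. 1 - pickup_prob lam (stop (R' q) i) (interval T K R' u q i))
        * (1 - pickup_prob lam cl (interval T K R' u q l))"
      using stop_l unfolding l by simp
    also have "\<dots> = fac R v q * (1 - pickup_prob lam cl (interval T K R' u q l))"
      unfolding fac_def using before[OF v, of "length cs"] vq uq l Rq by simp
    finally show "outcome_prob T lam K R' u
        = outcome_prob T lam K R (\<lambda>k. u k - (if k = q then 1 else 0)) *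
          (1 - pickup_prob lam cl (interval T K R' u q l))"
      using rest[OF v] by (simp add: split v_def[symmetric])
  qed
qed

end
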